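(* Let $\alpha,\beta\in\mathbb{R}_{>0}$, let $g^1,\ldots,g^L\in\mathbb{R}[[x]]^{\alpha}_{\beta}$ with $g^l_0=0$ for each $l$, and let $f\in\mathbb{R}\{y_1,\ldots,y_L\}$ be a real power series in $L$ variables with nonzero radius of convergence (i.e., analytic at the origin). Then $h(x)=f(g^1(x),\ldots,g^L(x))\in\mathbb{R}[[x]]^{\alpha}_{\beta}$ and $$(\mathcal{A}^\alpha_\beta h)(x)=\sum_{l=1}^L\frac{\partial f}{\partial y_l}(g^1(x),\ldots,g^L(x))\,(\mathcal{A}^\alpha_\beta g^l)(x).$$
   Context: For $f(x)=\sum_{n\ge0}f_nx^n\in\mathbb{R}[[x]]$, $f_n=[x^n]f(x)$. For sequences, $b_n\in O(a_n)$ means $\limsup_{n\to\infty}|b_n/a_n|<\infty$. For $\alpha,\beta\in\mathbb{R}_{>0}$, $\mathbb{R}[[x]]^{\alpha}_{\beta}$ is the set of $f\in\mathbb{R}[[x]]$ for which there exists a real sequence $(c_k)_{k\ge0}$ with $f_n=\sum_{k=0}^{R-1}c_k\alpha^{n+\beta-k}\Gamma(n+\beta-k)+O(\alpha^n\Gamma(n+\beta-R))$ as $n\to\infty$ for every $R\in\mathbb{N}_0$; this sequence is unique. The map $\mathcal{A}^\alpha_\beta:\mathbb{R}[[x]]^{\alpha}_{\beta}\to\mathbb{R}[[x]]$ sends $f$ to $\sum_kc_kx^k$. *)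

theory Defs
  imports "HOL-Analysis.Analysis" "HOL-Library.Landau_Symbols"
    "HOL-Computational_Algebra.Formal_Power_Series"
begin

text \<open>
  The finitely many \<open>n\<close> for which \<open>real n + \<beta> - real k\<close> is a pole of \<open>Gamma\<close> do not matter,
  since the condition is asymptotic. The function in the error term is eventually nonzero, so that
  \<open>O\<close> agrees with boundedness of the limes superior of the absolute quotients.
\<close>

definition has_factorial_expansion ::
    "real \<Rightarrow> real \<Rightarrow> real fps \<Rightarrow> (nat \<Rightarrow> real) \<Rightarrow> bool" where
  "has_factorial_expansion \<alpha> \<beta> f c \<longleftrightarrow>
     (\<forall>R::nat. (\<lambda>n. fps_nth f n -
          (\<Sum>k<R. c k * \<alpha> powr (real n + \<beta> - real k) * Gamma (real n + \<beta> - real k)))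
        \<in> O(\<lambda>n. \<alpha> ^ n * Gamma (real n + \<beta> - real R)))"

definition factorial_fps :: "real \<Rightarrow> real \<Rightarrow> real fps set" where
  "factorial_fps \<alpha> \<beta> = {f. \<exists>c. has_factorial_expansion \<alpha> \<beta> f c}"

definition alien_deriv :: "real \<Rightarrow> real \<Rightarrow> real fps \<Rightarrow> real fps" where
  "alien_deriv \<alpha> \<beta> f = Abs_fps (THE c. has_factorial_expansion \<alpha> \<beta> f c)"

text \<open>
  A real formal power series in finitely many variables, indexed by a finite type \<open>'l\<close>
  (so \<open>L\<close> is \<open>CARD('l)\<close>), is represented by its coefficients: \<open>F m\<close> is the coefficient of the
  monomial with exponent \<open>m i\<close> at the variable \<open>i\<close>.
\<close>

type_synonym 'l mfps = "('l \<Rightarrow> nat) \<Rightarrow> real"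

definition mfps_convergent :: "'l::finite mfps \<Rightarrow> bool" where
  "mfps_convergent F \<longleftrightarrow>
     (\<exists>r>0. \<forall>y :: 'l \<Rightarrow> real. (\<forall>i. \<bar>y i\<bar> < r) \<longrightarrow>
        (\<lambda>m. F m * (\<Prod>i\<in>UNIV. y i ^ m i)) summable_on UNIV)"

definition mfps_pderiv :: "'l \<Rightarrow> 'l mfps \<Rightarrow> 'l mfps" where
  "mfps_pderiv l F = (\<lambda>m. real (Suc (m l)) * F (m(l := Suc (m l))))"

text \<open>
  As for \<^const>\<open>fps_compose\<close>, only multi-indices of total degree at most \<open>n\<close> enter the \<open>n\<close>-th
  coefficient. If all \<open>G i\<close> have vanishing constant term, the other ones do not contribute.
\<close>

definition mfps_compose :: "'l::finite mfps \<Rightarrow> ('l \<Rightarrow> real fps) \<Rightarrow> real fps" where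
  "mfps_compose F G = Abs_fps (\<lambda>n. \<Sum>m | (\<Sum>i\<in>UNIV. m i) \<le> n.
     F m * fps_nth (\<Prod>i\<in>UNIV. G i ^ m i) n)"

lemma finite_multi_indices: "finite {m :: 'l::finite \<Rightarrow> nat. (\<Sum>i\<in>UNIV. m i) \<le> n}"
proof (rule finite_subset)
  show "{m :: 'l \<Rightarrow> nat. (\<Sum>i\<in>UNIV. m i) \<le> n} \<subseteq> (UNIV \<rightarrow>\<^sub>E {..n})"
  proof
    fix m :: "'l \<Rightarrow> nat"
    assume "m \<in> {m. (\<Sum>i\<in>UNIV. m i) \<le> n}"
    moreover have "m i \<le> (\<Sum>i\<in>UNIV. m i)" for i
      by (rule member_le_sum) auto
    ultimately show "m \<in> UNIV \<rightarrow>\<^sub>E {..n}"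
      by (auto intro: order_trans)
  qed
  show "finite ((UNIV :: 'l set) \<rightarrow>\<^sub>E {..n})"
    by (rule finite_PiE) auto
qed

lemma mfps_monomial_nth_eq_0:
  fixes G :: "'l::finite \<Rightarrow> real fps"
  assumes "\<And>i. fps_nth (G i) 0 = 0" and "n < (\<Sum>i\<in>UNIV. m i)"
  shows "fps_nth (\<Prod>i\<in>UNIV. G i ^ m i) n = 0"
proof -
  have "fps_X ^ (\<Sum>i\<in>UNIV. m i) dvd (\<Prod>i\<in>UNIV. G i ^ m i)"
  proof -
    have "fps_X dvd G i" for i
    proof
      show "G i = fps_X * fps_shift 1 (G i)"
        using assms(1)[of i] by (auto simp: fps_eq_iff)
    qed
    then have "(\<Prod>i\<in>UNIV. fps_X ^ m i) dvd (\<Prod>i\<in>UNIV. G i ^ m i)"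
      by (intro prod_dvd_prod dvd_power_same)
    then show ?thesis
      by (simp add: power_sum)
  qed
  then obtain H where "(\<Prod>i\<in>UNIV. G i ^ m i) = fps_X ^ (\<Sum>i\<in>UNIV. m i) * H" ..
  then show ?thesis
    using assms(2) by (simp add: fps_X_power_mult_nth)
qed

end

theory Submission
  imports Defs
begin

text \<open>
  With \<open>A n = \<alpha> powr (n + \<beta>) * Gamma (n + \<beta>)\<close>, the expansion of order \<open>R\<close> says that
  \<open>f - C * A\<close> has coefficients in \<open>O(A (n - R))\<close>, where \<open>C\<close> is the truncation of \<open>\<Sum> c k x^k\<close> below
  degree \<open>R\<close>. Since \<open>A\<close> is log-convex and grows factorially, the series with coefficients in
  \<open>O(A (n - R))\<close> form an algebra that is closed under \<open>s \<mapsto> 1 / (1 - s)\<close> for \<open>s\<close> without constant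
  term, and the product of two series in \<open>O(A n)\<close> of order at least \<open>R\<close> lies in \<open>O(A (n - R))\<close>.

  Split \<open>g = P + T\<close> with \<open>P\<close> the polynomial truncation below degree \<open>R + 1\<close> and expand
  \<open>f (P + T)\<close> to first order in \<open>T\<close>. The term \<open>f P\<close> is negligible, the linear term produces the chain
  rule, and the remainder is majorized by a multiple of \<open>t\<^sup>2 / (1 - 2 D s)\<close>, where \<open>s\<close> is the sum of
  the coefficientwise absolute values of the \<open>g l\<close>, \<open>t\<close> its tail, and \<open>D\<close> bounds the growth of the
  coefficients of \<open>f\<close>. All multivariate estimates thereby reduce to one geometric series.
\<close>

section \<open>Series dominated by a weight\<close>

definition dominated :: "(nat \<Rightarrow> real) \<Rightarrow> real fps \<Rightarrow> bool" where
  "dominated w f \<longleftrightarrow> fps_nth f \<in> O(w)"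

text \<open>The sum is the convolution at \<open>Suc n\<close> without its two end terms. Bounding
  it by \<open>w n\<close>, one index lower, is the gain that lets a geometric series stay in the
  class.\<close>

definition convolution_weight :: "(nat \<Rightarrow> real) \<Rightarrow> bool" where
  "convolution_weight w \<longleftrightarrow>
     (\<forall>n. w n > 0) \<and>
     (\<forall>\<epsilon>>0. \<forall>\<^sub>F n in sequentially. w n \<le> \<epsilon> * w (Suc n)) \<and>
     (\<exists>C. \<forall>n. (\<Sum>k=1..n. w k * w (Suc n - k)) \<le> C * w n)"

text \<open>Positivity of \<open>w\<close> lets the constant absorb the finitely many exceptional
  indices. Asymptotic bounds thus become uniform ones, which convolution sums and inductions
  require.\<close>

lemma bounded_of_eventually_bounded:
  fixes w f :: "nat \<Rightarrow> real"
  assumes w: "\<And>n. w n > 0" and ev: "\<forall>\<^sub>F n in sequentially. f n \<le> C * w n"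
  shows "\<exists>C'>0. \<forall>n. f n \<le> C' * w n"
proof -
  from ev obtain n0 where n0: "\<And>n. n \<ge> n0 \<Longrightarrow> f n \<le> C * w n"
    by (auto simp: eventually_sequentially)
  define C' where "C' = \<bar>C\<bar> + 1 + (\<Sum>n<n0. \<bar>f n\<bar> / w n)"
  have S: "(\<Sum>n<n0. \<bar>f n\<bar> / w n) \<ge> 0"
    using w by (intro sum_nonneg) (simp add: less_imp_le)
  have "f n \<le> C' * w n" for n
  proof (cases "n < n0")
    case True
    have "\<bar>f n\<bar> / w n \<le> (\<Sum>n<n0. \<bar>f n\<bar> / w n)"
      using w True by (intro member_le_sum) (auto simp: less_imp_le)
    then have "\<bar>f n\<bar> / w n \<le> C'"
      by (simp add: C'_def)
    then show ?thesis
      using w[of n] by (simp add: field_simps)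
  next
    case False
    then have "f n \<le> C * w n"
      by (simp add: n0)
    also have "\<dots> \<le> C' * w n"
      using w[of n] S by (intro mult_right_mono) (auto simp: C'_def)
    finally show ?thesis .
  qed
  moreover have "C' > 0"
    using S by (simp add: C'_def)
  ultimately show ?thesis
    by blast
qed

lemma dominatedI: "(\<And>n. \<bar>fps_nth f n\<bar> \<le> C * w n) \<Longrightarrow> (\<And>n. w n > 0) \<Longrightarrow> dominated w f"
  unfolding dominated_def by (rule bigoI[where c = C]) (auto simp: less_imp_le)

lemma dominatedE:
  assumes "dominated w f" and w: "\<And>n. w n > 0"
  obtains C where "C > 0" "\<And>n. \<bar>fps_nth f n\<bar> \<le> C * w n"
proof -
  obtain c where "c > 0" "\<forall>\<^sub>F n in sequentially. \<bar>fps_nth f n\<bar> \<le> c * w n"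
    using assms(1) w by (auto simp: dominated_def less_imp_le elim!: landau_o.bigE)
  from bounded_of_eventually_bounded[OF w this(2)] that show ?thesis
    by blast
qed

lemma dominated_add: "dominated w f \<Longrightarrow> dominated w g \<Longrightarrow> dominated w (f + g)"
  using sum_in_bigo(1)[of "fps_nth f" sequentially w "fps_nth g"]
  by (simp add: dominated_def flip: fps_add_nth)

lemma dominated_diff: "dominated w f \<Longrightarrow> dominated w g \<Longrightarrow> dominated w (f - g)"
  using sum_in_bigo(2)[of "fps_nth f" sequentially w "fps_nth g"]
  by (simp add: dominated_def flip: fps_sub_nth)

lemma dominated_sum:
  "(\<And>i. i \<in> I \<Longrightarrow> dominated w (f i)) \<Longrightarrow> dominated w (\<Sum>i\<in>I. f i)"
  using big_sum_in_bigo[of I "\<lambda>i. fps_nth (f i)" sequentially w]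
  by (simp add: dominated_def flip: fps_sum_nth)

lemma dominated_cutoff: "dominated w (fps_cutoff N f)"
  unfolding dominated_def
proof (rule bigoI[where c = 0])
  show "\<forall>\<^sub>F n in sequentially. norm (fps_nth (fps_cutoff N f) n) \<le> 0 * norm (w n)"
    using eventually_ge_at_top[of N] by eventually_elim simp
qed

text \<open>Transfers domination from a majorant to the series it bounds. The sign of
  \<open>c\<close> is left open, so the proof passes to its absolute value.\<close>

lemma dominated_by_multiple:
  assumes "dominated w g" "\<And>n. \<bar>fps_nth f n\<bar> \<le> c * fps_nth g n"
  shows "dominated w f"
proof -
  have "fps_nth f \<in> O(fps_nth g)"
  proof (rule bigoI[where c = "\<bar>c\<bar>"], rule always_eventually, rule allI)
    fix n
    have "c * fps_nth g n \<le> \<bar>c\<bar> * \<bar>fps_nth g n\<bar>"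
      by (metis abs_ge_self abs_mult)
    then show "norm (fps_nth f n) \<le> \<bar>c\<bar> * norm (fps_nth g n)"
      using assms(2)[of n] by simp
  qed
  then show ?thesis
    using assms(1) unfolding dominated_def by (rule landau_o.big_trans)
qed

section \<open>The algebra of series dominated by a convolution weight\<close>

context
  fixes w :: "nat \<Rightarrow> real"
  assumes W: "convolution_weight w"
begin

lemma weight_pos: "w n > 0"
  using W by (simp add: convolution_weight_def)

lemma weight_ratio:
  obtains B where "B > 0" "\<And>n. w n \<le> B * w (Suc n)"
proof -
  have "\<forall>\<^sub>F n in sequentially. w n \<le> 1 * w (Suc n)"
    using W unfolding convolution_weight_def by (auto dest: spec[of _ "1::real"])
  from bounded_of_eventually_bounded[OF weight_pos this] that show ?thesis
    by blast
qed

lemma weight_convolution: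
  obtains C where "C > 0" "\<And>n. (\<Sum>k=1..n. w k * w (Suc n - k)) \<le> C * w n"
proof -
  obtain C where "\<And>n. (\<Sum>k=1..n. w k * w (Suc n - k)) \<le> C * w n"
    using W by (auto simp: convolution_weight_def)
  then have "\<forall>\<^sub>F n in sequentially. (\<Sum>k=1..n. w k * w (Suc n - k)) \<le> C * w n"
    by simp
  from bounded_of_eventually_bounded[OF weight_pos this] that show ?thesis
    by blast
qed

text \<open>The end terms contribute \<open>2 * w 0 * w n\<close>; the inner ones are bounded by
  \<open>w (n - 1)\<close> up to a constant, hence by \<open>w n\<close>.\<close>

lemma weight_full_convolution:
  obtains C where "C > 0" "\<And>n. (\<Sum>k=0..n. w k * w (n - k)) \<le> C * w n"
proof -
  obtain B where B: "B > 0" "\<And>n. w n \<le> B * w (Suc n)"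
    using weight_ratio by blast
  obtain C where C: "C > 0" "\<And>n. (\<Sum>k=1..n. w k * w (Suc n - k)) \<le> C * w n"
    using weight_convolution by blast
  have "(\<Sum>k=0..n. w k * w (n - k)) \<le> (2 * w 0 + C * B) * w n" for n
  proof (cases n)
    case 0
    then show ?thesis
      using weight_pos[of 0] C(1) B(1) by (simp add: algebra_simps)
  next
    case (Suc j)
    have "(\<Sum>k=0..n. w k * w (n - k)) = 2 * w 0 * w n + (\<Sum>k=1..j. w k * w (Suc j - k))"
      by (simp add: Suc sum.atLeast_Suc_atMost[of 0])
    also have "\<dots> \<le> 2 * w 0 * w n + C * w j"
      using C(2)[of j] by simp
    also have "\<dots> \<le> 2 * w 0 * w n + C * (B * w n)"
      using C(1) B(2)[of j] by (simp add: Suc)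
    finally show ?thesis
      by (simp add: algebra_simps)
  qed
  then show ?thesis
    using that[of "2 * w 0 + C * B"] B(1) C(1) weight_pos[of 0] by (simp add: add_pos_pos)
qed

lemma dominated_mult:
  assumes "dominated w f" "dominated w g"
  shows "dominated w (f * g)"
proof -
  obtain C1 where C1: "C1 > 0" "\<And>n. \<bar>fps_nth f n\<bar> \<le> C1 * w n"
    using dominatedE[OF assms(1)] weight_pos by blast
  obtain C2 where C2: "C2 > 0" "\<And>n. \<bar>fps_nth g n\<bar> \<le> C2 * w n"
    using dominatedE[OF assms(2)] weight_pos by blast
  obtain C where C: "C > 0" "\<And>n. (\<Sum>k=0..n. w k * w (n - k)) \<le> C * w n"
    using weight_full_convolution by blast
  show ?thesis
  proof (rule dominatedI)
    fix n
    have "\<bar>fps_nth (f * g) n\<bar> \<le> (\<Sum>k=0..n. \<bar>fps_nth f k\<bar> * \<bar>fps_nth g (n - k)\<bar>)"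
      by (simp add: fps_mult_nth sum_abs flip: abs_mult)
    also have "\<dots> \<le> (\<Sum>k=0..n. (C1 * w k) * (C2 * w (n - k)))"
      using C1 C2 weight_pos by (intro sum_mono mult_mono) (auto simp: less_imp_le)
    also have "\<dots> = C1 * C2 * (\<Sum>k=0..n. w k * w (n - k))"
      by (simp add: sum_distrib_left mult_ac)
    also have "\<dots> \<le> C1 * C2 * (C * w n)"
      using C1(1) C2(1) C(2)[of n] by (intro mult_left_mono) auto
    finally show "\<bar>fps_nth (f * g) n\<bar> \<le> (C1 * C2 * C) * w n"
      by (simp add: mult_ac)
  qed (rule weight_pos)
qed

text \<open>The inverse \<open>u\<close> solves \<open>u = 1 + s * u\<close>, a recursion because
  \<open>s\<close> has no constant term, so strong induction gives \<open>K * w n\<close>. The inner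
  terms of the convolution cost only \<open>w (n - 1)\<close>, which is eventually a small fraction
  of \<open>w n\<close>.\<close>

lemma dominated_geometric:
  assumes "dominated w s" and s0: "fps_nth s 0 = 0"
  shows "dominated w (inverse (1 - s))"
proof -
  define u where "u = inverse (1 - s)"
  have "u * (1 - s) = 1"
    unfolding u_def using s0 by (intro inverse_mult_eq_1) simp
  then have u: "u = 1 + s * u"
    by (simp add: algebra_simps)
  have u0: "fps_nth u 0 = 1"
    by (subst u) (simp add: s0)
  obtain S where S: "S > 0" "\<And>n. \<bar>fps_nth s n\<bar> \<le> S * w n"
    using dominatedE[OF assms(1)] weight_pos by blast
  obtain C where C: "C > 0" "\<And>n. (\<Sum>k=1..n. w k * w (Suc n - k)) \<le> C * w n"
    using weight_convolution by blast
  have "\<forall>\<^sub>F n in sequentially. w n \<le> (1 / (2 * S * C)) * w (Suc n)"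
    using W S(1) C(1) unfolding convolution_weight_def
    by (auto dest: spec[of _ "1 / (2 * S * C)"])
  then obtain n0 where n0: "\<And>n. n \<ge> n0 \<Longrightarrow> w n \<le> (1 / (2 * S * C)) * w (Suc n)"
    by (auto simp: eventually_sequentially)
  \<comment> \<open>The sum covers the indices up to \<open>n0\<close>. Beyond \<open>n0\<close> the
    inner terms use up half of \<open>K * w n\<close>, and \<open>2 * S\<close> ensures that the end
    term \<open>S * w n\<close> fits into the other half.\<close>
  define K where "K = 2 * S + (\<Sum>n\<le>n0. \<bar>fps_nth u n\<bar> / w n)"
  have "(\<Sum>n\<le>n0. \<bar>fps_nth u n\<bar> / w n) \<ge> 0"
    using weight_pos by (intro sum_nonneg) (simp add: less_imp_le)
  then have K: "K \<ge> 2 * S" "K > 0"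
    using S(1) by (auto simp: K_def)
  have "\<bar>fps_nth u n\<bar> \<le> K * w n" for n
  proof (induction n rule: less_induct)
    case (less n)
    show ?case
    proof (cases "n \<le> n0")
      case True
      have "\<bar>fps_nth u n\<bar> / w n \<le> (\<Sum>n\<le>n0. \<bar>fps_nth u n\<bar> / w n)"
        using weight_pos True by (intro member_le_sum) (auto simp: less_imp_le)
      then have "\<bar>fps_nth u n\<bar> / w n \<le> K"
        using S(1) by (simp add: K_def)
      then show ?thesis
        using weight_pos[of n] by (simp add: field_simps)
    next
      case False
      then obtain j where j: "n = Suc j" "j \<ge> n0"
        by (cases n) auto
      have "fps_nth u n = (\<Sum>k=0..n. fps_nth s k * fps_nth u (n - k))"
        by (subst u) (simp add: fps_mult_nth j)
      \<comment> \<open>The term at 0 vanishes with the constant term of \<open>s\<close>, and the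
        term at \<open>n\<close> is the coefficient of \<open>s\<close> itself because
        \<open>u\<close> starts with 1.\<close>
      also have "\<dots> = (\<Sum>k=1..j. fps_nth s k * fps_nth u (Suc j - k)) + fps_nth s n"
        by (simp add: j sum.atLeast_Suc_atMost[of 0] s0 u0)
      finally have "\<bar>fps_nth u n\<bar> \<le>
          (\<Sum>k=1..j. \<bar>fps_nth s k * fps_nth u (Suc j - k)\<bar>) + \<bar>fps_nth s n\<bar>"
        using sum_abs[of "\<lambda>k. fps_nth s k * fps_nth u (Suc j - k)" "{1..j}"] by linarith
      also have "\<dots> \<le> (\<Sum>k=1..j. (S * w k) * (K * w (Suc j - k))) + S * w n"
        unfolding abs_mult using S K weight_pos
        by (intro add_mono sum_mono mult_mono less.IH) (auto simp: j less_imp_le)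
      also have "\<dots> = S * K * (\<Sum>k=1..j. w k * w (Suc j - k)) + S * w n"
        by (simp add: sum_distrib_left mult_ac)
      also have "\<dots> \<le> S * K * (C * w j) + S * w n"
        using C(2)[of j] S(1) K(2) by simp
      also have "\<dots> \<le> S * K * (C * (1 / (2 * S * C) * w n)) + S * w n"
        using n0[OF j(2)] S(1) K(2) C(1) unfolding j by (intro add_right_mono mult_left_mono) auto
      also have "\<dots> = (K / 2 + S) * w n"
        using S(1) C(1) by (simp add: field_simps)
      also have "\<dots> \<le> K * w n"
        using K weight_pos[of n] by (intro mult_right_mono) auto
      finally show ?thesis .
    qed
  qed
  then show ?thesis
    unfolding u_def[symmetric] by (rule dominatedI) (rule weight_pos)
qed

text \<open>For positive \<open>n\<close>, the convolution without end terms for the shifted weight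
  is the full convolution of \<open>w\<close> at \<open>n - 1\<close>. Truncated subtraction repeats
  the value \<open>w 0\<close>, which keeps the shifted weight positive everywhere.\<close>

lemma convolution_weight_Suc_shift: "convolution_weight (\<lambda>n. w (n - 1))"
  unfolding convolution_weight_def
proof (intro conjI allI impI)
  show "w (n - 1) > 0" for n
    by (rule weight_pos)
next
  fix \<epsilon> :: real
  assume "\<epsilon> > 0"
  then have "\<forall>\<^sub>F n in sequentially. w n \<le> \<epsilon> * w (Suc n)"
    using W by (simp add: convolution_weight_def)
  then have "\<forall>\<^sub>F n in sequentially. w (Suc n - 1) \<le> \<epsilon> * w (Suc (Suc n) - 1)"
    by simp
  then show "\<forall>\<^sub>F n in sequentially. w (n - 1) \<le> \<epsilon> * w (Suc n - 1)"
    by (subst (asm) eventually_sequentially_Suc)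
next
  obtain B where B: "B > 0" "\<And>n. w n \<le> B * w (Suc n)"
    using weight_ratio by blast
  obtain C where C: "C > 0" "\<And>n. (\<Sum>k=1..n. w k * w (Suc n - k)) \<le> C * w n"
    using weight_convolution by blast
  have "(\<Sum>k=1..n. w (k - 1) * w (Suc n - k - 1)) \<le> (2 * w 0 + C * B) * w (n - 1)" for n
  proof -
    consider "n = 0" | "n = 1" | j where "n = Suc (Suc j)"
      by (metis One_nat_def old.nat.exhaust)
    then show ?thesis
    proof cases
      case 3
      have "(\<Sum>k=1..n. w (k - 1) * w (Suc n - k - 1)) = (\<Sum>k=0..Suc j. w k * w (Suc j - k))"
        unfolding 3 by (rule sum.reindex_bij_witness[of _ Suc "\<lambda>k. k - 1"]) auto
      also have "\<dots> = 2 * w 0 * w (Suc j) + (\<Sum>k=1..j. w k * w (Suc j - k))"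
        by (simp add: sum.atLeast_Suc_atMost[of 0])
      also have "\<dots> \<le> 2 * w 0 * w (Suc j) + C * w j"
        using C(2)[of j] by simp
      also have "\<dots> \<le> 2 * w 0 * w (Suc j) + C * (B * w (Suc j))"
        using C(1) B(2)[of j] by simp
      finally show ?thesis
        by (simp add: 3 algebra_simps)
    qed (use weight_pos[of 0] B(1) C(1) in \<open>auto simp: algebra_simps\<close>)
  qed
  then show "\<exists>C. \<forall>n. (\<Sum>k=1..n. w (k - 1) * w (Suc n - k - 1)) \<le> C * w (n - 1)"
    by blast
qed

text \<open>Domination ignores the first \<open>N\<close> coefficients, and from there on
  \<open>w (n + N - N)\<close> is \<open>w n\<close>.\<close>

lemma dominated_shift_iff:
  "dominated (\<lambda>n. w (n - N)) f \<longleftrightarrow> dominated w (fps_shift N f)"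
proof -
  have "fps_nth f \<in> O(\<lambda>n. w (n - N)) \<longleftrightarrow> (\<lambda>n. fps_nth f (n + N)) \<in> O(\<lambda>n. w (n + N - N))"
  proof
    assume "(\<lambda>n. fps_nth f (n + N)) \<in> O(\<lambda>n. w (n + N - N))"
    then obtain c where "\<forall>\<^sub>F n in sequentially. norm (fps_nth f (n + N)) \<le> c * norm (w (n + N - N))"
      by (auto elim!: landau_o.bigE)
    then have "\<forall>\<^sub>F n in sequentially. norm (fps_nth f n) \<le> c * norm (w (n - N))"
      by (rule eventually_sequentially_seg[THEN iffD1])
    then show "fps_nth f \<in> O(\<lambda>n. w (n - N))"
      by (rule bigoI)
  next
    assume "fps_nth f \<in> O(\<lambda>n. w (n - N))"
    then show "(\<lambda>n. fps_nth f (n + N)) \<in> O(\<lambda>n. w (n + N - N))"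
      by (rule landau_o.big.compose) (rule filterlim_add_const_nat_at_top)
  qed
  then show ?thesis
    by (simp add: dominated_def flip: fps_shift_nth)
qed

end

lemma convolution_weight_shift:
  "convolution_weight w \<Longrightarrow> convolution_weight (\<lambda>n. w (n - N))"
proof (induction N)
  case (Suc N)
  from convolution_weight_Suc_shift[OF Suc.IH[OF Suc.prems]] show ?case
    by simp
qed simp

lemma dominated_X_power_mult:
  assumes "convolution_weight w" "dominated w f"
  shows "dominated (\<lambda>n. w (n - N)) (fps_X ^ N * f)"
proof -
  have "fps_shift N (fps_X ^ N * f) = f"
    by (simp add: fps_eq_iff fps_X_power_mult_nth)
  with assms show ?thesis
    by (simp add: dominated_shift_iff)
qed

section \<open>The Gamma weight\<close>

definition gamma_weight :: "real \<Rightarrow> real \<Rightarrow> nat \<Rightarrow> real" where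
  "gamma_weight \<alpha> \<beta> n = \<alpha> powr (real n + \<beta>) * Gamma (real n + \<beta>)"

context
  fixes \<alpha> \<beta> :: real
  assumes \<alpha>: "\<alpha> > 0" and \<beta>: "\<beta> > 0"
begin

private abbreviation "A \<equiv> gamma_weight \<alpha> \<beta>"

lemma gamma_weight_pos: "A n > 0"
  using \<alpha> \<beta> by (simp add: gamma_weight_def)

lemma gamma_weight_Suc: "A (Suc n) = \<alpha> * (real n + \<beta>) * A n"
proof -
  have "real n + \<beta> \<notin> \<int>\<^sub>\<le>\<^sub>0"
    using \<beta> nonpos_Ints_nonpos[of "real n + \<beta>"] by force
  from Gamma_plus1[OF this] have "Gamma (1 + (real n + \<beta>)) = (real n + \<beta>) * Gamma (real n + \<beta>)"
    by (simp add: add.commute)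
  then show ?thesis
    using \<alpha> by (simp add: gamma_weight_def powr_add powr_mult_base mult_ac add_ac)
qed

text \<open>This is log-convexity: the ratio
  \<open>A (Suc n) / A n = \<alpha> * (n + \<beta>)\<close> increases, so moving two indices apart
  while keeping their sum increases the product. The induction moves one unit at a time.\<close>

lemma gamma_weight_exchange:
  assumes "M \<le> k" "M \<le> j"
  shows "A k * A j \<le> A M * A (k + j - M)"
proof -
  have "A (M + i) * A j \<le> A M * A (j + i)" for i
  proof (induction i)
    case (Suc i)
    have "A (M + Suc i) * A j = \<alpha> * (real (M + i) + \<beta>) * (A (M + i) * A j)"
      by (simp add: gamma_weight_Suc)
    also have "\<dots> \<le> \<alpha> * (real (j + i) + \<beta>) * (A M * A (j + i))"
      using Suc.IH assms(2) \<alpha> \<beta> gamma_weight_pos[THEN less_imp_le]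
      by (intro mult_mono[where a = "\<alpha> * _"] mult_left_mono) simp_all
    also have "\<dots> = A M * A (j + Suc i)"
      by (simp add: gamma_weight_Suc)
    finally show ?case .
  qed simp
  from this[of "k - M"] show ?thesis
    using assms by (simp add: add.commute)
qed

text \<open>The ratio of consecutive weights grows linearly, so lowering the index by one pays for a
  sum of about \<open>n\<close> equal terms.\<close>

lemma gamma_weight_lower_ratio: "real (Suc n) * A n \<le> (1 + 1 / \<beta>) / \<alpha> * A (Suc n)"
proof -
  have "1 * real (Suc n) \<le> (1 + 1 / \<beta>) * (real n + \<beta>)"
    using \<beta> by (simp add: field_simps)
  then have "real (Suc n) * A n \<le> (1 + 1 / \<beta>) * (real n + \<beta>) * A n"
    using gamma_weight_pos[of n] by (intro mult_right_mono) auto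
  also have "\<dots> = (1 + 1 / \<beta>) / \<alpha> * A (Suc n)"
    using \<alpha> by (simp add: gamma_weight_Suc)
  finally show ?thesis .
qed

text \<open>The two end terms are \<open>A N * A n\<close>. By log-convexity every inner term is at
  most \<open>A (Suc N) * A (n - 1)\<close>, and at most \<open>n\<close> such terms amount to a
  multiple of \<open>A n\<close>.\<close>

lemma gamma_weight_tail_convolution:
  "\<exists>C>0. \<forall>n. (\<Sum>k=N..n. A k * A (n + N - k)) \<le> C * A n"
proof -
  define B where "B = (1 + 1 / \<beta>) / \<alpha>"
  have B: "B > 0"
    using \<alpha> \<beta> by (simp add: B_def add_pos_pos)
  have "(\<Sum>k=N..n. A k * A (n + N - k)) \<le> (2 * A N + A (Suc N) * B) * A n" for n
  proof (cases n)
    case 0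
    then show ?thesis
      using gamma_weight_pos[THEN less_imp_le] B by (cases N) (auto simp: algebra_simps)
  next
    case (Suc j)
    \<comment> \<open>The three summands may overlap, which is harmless for an upper bound.
      Excluding \<open>k = 0\<close> from the last one makes its sum over \<open>{0..n}\<close>
      contain exactly \<open>n\<close> equal terms.\<close>
    have "(\<Sum>k=N..n. A k * A (n + N - k)) \<le>
        (\<Sum>k=N..n. (if k = N then A N * A n else 0) + (if k = n then A N * A n else 0) +
          (if k = 0 then 0 else A (Suc N) * A j))"
    proof (rule sum_mono)
      fix k
      assume k: "k \<in> {N..n}"
      have pos: "A N * A n > 0" "A (Suc N) * A j > 0"
        by (simp_all add: gamma_weight_pos)
      consider "k = N" | "k = n" | "Suc N \<le> k" "k < n"
        using k by fastforce
      then show "A k * A (n + N - k) \<le>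
        (if k = N then A N * A n else 0) + (if k = n then A N * A n else 0) +
          (if k = 0 then 0 else A (Suc N) * A j)"
      proof cases
        case 3
        then have "A k * A (n + N - k) \<le> A (Suc N) * A (k + (n + N - k) - Suc N)"
          by (intro gamma_weight_exchange) auto
        then show ?thesis
          using 3 by (simp add: Suc)
      qed (use pos in \<open>auto simp: mult.commute\<close>)
    qed
    also have "\<dots> \<le> A N * A n + A N * A n + real n * (A (Suc N) * A j)"
    proof -
      have "(\<Sum>k=N..n. if k = 0 then 0 else A (Suc N) * A j) \<le>
          (\<Sum>k=0..n. if k = 0 then 0 else A (Suc N) * A j)"
        by (intro sum_mono2) (auto intro!: mult_nonneg_nonneg simp: gamma_weight_pos less_imp_le)
      also have "\<dots> = real n * (A (Suc N) * A j)"
        by (simp add: sum.atLeast_Suc_atMost[of 0])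
      finally show ?thesis
        by (simp add: sum.distrib gamma_weight_pos less_imp_le)
    qed
    also have "real n * (A (Suc N) * A j) = A (Suc N) * (real (Suc j) * A j)"
      by (simp add: Suc)
    also have "\<dots> \<le> A (Suc N) * (B * A (Suc j))"
      unfolding B_def using gamma_weight_pos[of "Suc N"]
      by (intro mult_left_mono gamma_weight_lower_ratio) auto
    finally show ?thesis
      by (simp add: Suc algebra_simps)
  qed
  moreover have "2 * A N + A (Suc N) * B > 0"
    using gamma_weight_pos B by (simp add: add_pos_pos)
  ultimately show ?thesis
    by blast
qed

lemma convolution_weight_gamma_weight: "convolution_weight A"
  unfolding convolution_weight_def
proof (intro conjI allI impI)
  fix \<epsilon> :: real
  assume \<epsilon>: "\<epsilon> > 0"
  obtain n0 :: nat where n0: "1 / (\<epsilon> * \<alpha>) \<le> real n0"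
    using real_arch_simple by blast
  show "\<forall>\<^sub>F n in sequentially. A n \<le> \<epsilon> * A (Suc n)"
    using eventually_ge_at_top[of n0]
  proof eventually_elim
    case (elim n)
    then have "1 / (\<epsilon> * \<alpha>) \<le> real n + \<beta>"
      using n0 \<beta> by linarith
    then have "1 \<le> \<epsilon> * \<alpha> * (real n + \<beta>)"
      using \<epsilon> \<alpha> by (simp add: field_simps)
    then have "1 * A n \<le> \<epsilon> * \<alpha> * (real n + \<beta>) * A n"
      using gamma_weight_pos[of n] by (intro mult_right_mono) auto
    then show ?case
      by (simp add: gamma_weight_Suc)
  qed
next
  show "\<exists>C. \<forall>n. (\<Sum>k=1..n. A k * A (Suc n - k)) \<le> C * A n"
    using gamma_weight_tail_convolution[of 1] by auto
qed (rule gamma_weight_pos)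

text \<open>Since both factors start at degree \<open>N\<close>, their product is
  \<open>fps_X ^ N * v\<close>, and the coefficients of \<open>v\<close> are tail convolutions. The
  gain of \<open>N\<close> indices makes terms of second order in the tail negligible.\<close>

lemma dominated_tail_product:
  assumes f: "dominated A f" "\<And>k. k < N \<Longrightarrow> fps_nth f k = 0"
    and g: "dominated A g" "\<And>k. k < N \<Longrightarrow> fps_nth g k = 0"
    and u: "dominated A u"
  shows "dominated (\<lambda>n. A (n - N)) (f * g * u)"
proof -
  define v where "v = fps_shift N (f * g)"
  obtain C1 where C1: "C1 > 0" "\<And>n. \<bar>fps_nth f n\<bar> \<le> C1 * A n"
    using dominatedE[OF f(1)] gamma_weight_pos by blast
  obtain C2 where C2: "C2 > 0" "\<And>n. \<bar>fps_nth g n\<bar> \<le> C2 * A n"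
    using dominatedE[OF g(1)] gamma_weight_pos by blast
  obtain C where C: "C > 0" "\<And>n. (\<Sum>k=N..n. A k * A (n + N - k)) \<le> C * A n"
    using gamma_weight_tail_convolution by blast
  have fg: "fps_nth (f * g) n = 0" if "n < N" for n
    unfolding fps_mult_nth using that f(2) by (intro sum.neutral) auto
  have "\<bar>fps_nth v n\<bar> \<le> (C1 * C2 * C) * A n" for n
  proof -
    have "fps_nth v n = (\<Sum>k=0..n+N. fps_nth f k * fps_nth g (n + N - k))"
      by (simp add: v_def fps_mult_nth)
    \<comment> \<open>Indices below \<open>N\<close> are killed by \<open>f\<close>; those above
      \<open>n\<close> are killed by \<open>g\<close>, whose index is then below
      \<open>N\<close>.\<close>
    also have "\<dots> = (\<Sum>k=N..n. fps_nth f k * fps_nth g (n + N - k))"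
      using f(2) g(2) by (intro sum.mono_neutral_right) force+
    also have "\<bar>\<dots>\<bar> \<le> (\<Sum>k=N..n. \<bar>fps_nth f k\<bar> * \<bar>fps_nth g (n + N - k)\<bar>)"
      by (simp add: sum_abs flip: abs_mult)
    also have "\<dots> \<le> (\<Sum>k=N..n. (C1 * A k) * (C2 * A (n + N - k)))"
      using C1 C2 gamma_weight_pos by (intro sum_mono mult_mono) (auto simp: less_imp_le)
    also have "\<dots> = C1 * C2 * (\<Sum>k=N..n. A k * A (n + N - k))"
      by (simp add: sum_distrib_left mult_ac)
    also have "\<dots> \<le> C1 * C2 * (C * A n)"
      using C1(1) C2(1) C(2)[of n] by (intro mult_left_mono) auto
    finally show ?thesis
      by (simp add: mult_ac)
  qed
  then have "dominated A v"
    by (rule dominatedI) (rule gamma_weight_pos)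
  with u have "dominated (\<lambda>n. A (n - N)) (fps_X ^ N * (v * u))"
    by (intro dominated_X_power_mult dominated_mult convolution_weight_gamma_weight)
  also have "fps_X ^ N * (v * u) = f * g * u"
  proof -
    have "fps_X ^ N * v = f * g"
      using fg by (simp add: fps_eq_iff v_def fps_X_power_mult_nth)
    then show ?thesis
      by (simp flip: mult.assoc)
  qed
  finally show ?thesis .
qed

text \<open>Removing the truncation of \<open>e\<close> leaves \<open>fps_X ^ R\<close> times a
  series dominated by \<open>A\<close>. This allows a coefficient series to be truncated in front of
  \<open>Abs_fps A\<close>.\<close>

lemma dominated_mult_sub_cutoff:
  assumes e: "dominated (\<lambda>n. A (n - R)) e" and u: "dominated A u"
  shows "dominated (\<lambda>n. A (n - R)) (e * u - fps_cutoff R e * u)"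
proof -
  have "e * u - fps_cutoff R e * u = fps_X ^ R * (fps_shift R e * u)"
    using fps_shift_cutoff'[of R e] by (metis add_diff_cancel_right' left_diff_distrib mult.assoc)
  moreover have "dominated A (fps_shift R e)"
    using e dominated_shift_iff[OF convolution_weight_gamma_weight] by blast
  ultimately show ?thesis
    using u by (auto intro!: dominated_X_power_mult dominated_mult convolution_weight_gamma_weight)
qed

text \<open>For \<open>n \<ge> R\<close> the subtracted sum is the \<open>n\<close>-th coefficient
  of a Cauchy product, and the two error weights differ by the constant factor
  \<open>\<alpha> powr (\<beta> - R)\<close>. Smaller \<open>n\<close>, where natural subtraction
  truncates, do not affect domination.\<close>

lemma has_factorial_expansion_iff_dominated:
  "has_factorial_expansion \<alpha> \<beta> f c \<longleftrightarrow>
     (\<forall>R. dominated (\<lambda>n. A (n - R)) (f - fps_cutoff R (Abs_fps c) * Abs_fps A))"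
proof -
  have *: "(\<lambda>n. fps_nth f n -
          (\<Sum>k<R. c k * \<alpha> powr (real n + \<beta> - real k) * Gamma (real n + \<beta> - real k)))
        \<in> O(\<lambda>n. \<alpha> ^ n * Gamma (real n + \<beta> - real R)) \<longleftrightarrow>
      dominated (\<lambda>n. A (n - R)) (f - fps_cutoff R (Abs_fps c) * Abs_fps A)" for R
  proof -
    have 1: "\<forall>\<^sub>F n in sequentially. fps_nth f n -
          (\<Sum>k<R. c k * \<alpha> powr (real n + \<beta> - real k) * Gamma (real n + \<beta> - real k)) =
        fps_nth (f - fps_cutoff R (Abs_fps c) * Abs_fps A) n"
      using eventually_ge_at_top[of R]
    proof eventually_elim
      case (elim n)
      have "fps_nth (fps_cutoff R (Abs_fps c) * Abs_fps A) n =
          (\<Sum>k=0..n. (if k < R then c k else 0) * A (n - k))"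
        by (simp add: fps_mult_nth cong: if_cong)
      also have "\<dots> = (\<Sum>k<R. c k * A (n - k))"
        using elim by (intro sum.mono_neutral_cong_right) auto
      also have "\<dots> = (\<Sum>k<R. c k * \<alpha> powr (real n + \<beta> - real k) * Gamma (real n + \<beta> - real k))"
        using elim by (intro sum.cong) (auto simp: gamma_weight_def of_nat_diff algebra_simps)
      finally show ?case
        by simp
    qed
    have 2: "\<forall>\<^sub>F n in sequentially.
        \<alpha> powr (\<beta> - real R) * (\<alpha> ^ n * Gamma (real n + \<beta> - real R)) = A (n - R)"
      using eventually_ge_at_top[of R]
    proof eventually_elim
      case (elim n)
      have "real (n - R) + \<beta> = (\<beta> - real R) + real n"
        using elim by (simp add: of_nat_diff)
      then have "\<alpha> powr (real (n - R) + \<beta>) = \<alpha> powr (\<beta> - real R) * \<alpha> ^ n"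
        using \<alpha> by (simp only: powr_add powr_realpow)
      then show ?case
        using elim by (simp add: gamma_weight_def of_nat_diff algebra_simps)
    qed
    have "O(\<lambda>n. \<alpha> ^ n * Gamma (real n + \<beta> - real R)) =
        O(\<lambda>n. \<alpha> powr (\<beta> - real R) * (\<alpha> ^ n * Gamma (real n + \<beta> - real R)))"
      using \<alpha> by (subst landau_o.big.cmult) auto
    also have "\<dots> = O(\<lambda>n. A (n - R))"
      by (rule landau_o.big.cong[OF 2])
    finally show ?thesis
      unfolding dominated_def by (simp only: landau_o.big.in_cong[OF 1])
  qed
  show ?thesis
    unfolding has_factorial_expansion_def * ..
qed

text \<open>Take the first index \<open>k\<close> of disagreement and subtract the two expansions of
  order \<open>Suc k\<close>: a nonzero multiple of \<open>A (n - k)\<close> would be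
  \<open>O(A (n - k - 1))\<close>, against the growth of \<open>A\<close>.\<close>

lemma has_factorial_expansion_unique:
  assumes "has_factorial_expansion \<alpha> \<beta> f c" "has_factorial_expansion \<alpha> \<beta> f c'"
  shows "c = c'"
proof (rule ccontr)
  assume "c \<noteq> c'"
  then obtain k where k: "c k \<noteq> c' k" "\<And>j. j < k \<Longrightarrow> c j = c' j"
    using exists_least_iff[of "\<lambda>k. c k \<noteq> c' k"] by auto
  define d where "d = c' k - c k"
  have d: "d \<noteq> 0"
    using k by (simp add: d_def)
  have "dominated (\<lambda>n. A (n - Suc k)) ((f - fps_cutoff (Suc k) (Abs_fps c) * Abs_fps A) -
      (f - fps_cutoff (Suc k) (Abs_fps c') * Abs_fps A))"
    using assms unfolding has_factorial_expansion_iff_dominated by (blast intro: dominated_diff)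
  also have "(f - fps_cutoff (Suc k) (Abs_fps c) * Abs_fps A) -
      (f - fps_cutoff (Suc k) (Abs_fps c') * Abs_fps A) =
      (fps_cutoff (Suc k) (Abs_fps c') - fps_cutoff (Suc k) (Abs_fps c)) * Abs_fps A"
    by (simp add: algebra_simps)
  also have "fps_cutoff (Suc k) (Abs_fps c') - fps_cutoff (Suc k) (Abs_fps c) =
      fps_const d * fps_X ^ k"
    using k by (auto simp: fps_eq_iff d_def less_Suc_eq)
  finally have "dominated (\<lambda>n. A (n - Suc k)) (fps_const d * fps_X ^ k * Abs_fps A)" .
  then obtain C where C: "C > 0"
      "\<And>n. \<bar>fps_nth (fps_const d * fps_X ^ k * Abs_fps A) n\<bar> \<le> C * A (n - Suc k)"
    by (rule dominatedE) (auto simp: gamma_weight_pos)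
  have le: "\<bar>d\<bar> * A (Suc n) \<le> C * A n" for n
    using C(2)[of "Suc n + k"] gamma_weight_pos[of "Suc n"]
    by (simp add: mult.assoc fps_X_power_mult_nth abs_mult)
  have "\<forall>\<^sub>F n in sequentially. A n \<le> \<bar>d\<bar> / (2 * C) * A (Suc n)"
    using convolution_weight_gamma_weight d C(1) unfolding convolution_weight_def
    by (auto dest: spec[of _ "\<bar>d\<bar> / (2 * C)"])
  then obtain n where "A n \<le> \<bar>d\<bar> / (2 * C) * A (Suc n)"
    by (auto simp: eventually_sequentially)
  then have "C * A n \<le> C * (\<bar>d\<bar> / (2 * C) * A (Suc n))"
    using C(1) by (intro mult_left_mono) auto
  also have "\<dots> = \<bar>d\<bar> * A (Suc n) / 2"
    using C(1) by simp
  also have "\<dots> < \<bar>d\<bar> * A (Suc n)"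
    using d gamma_weight_pos[of "Suc n"] by simp
  finally show False
    using le[of n] by simp
qed

lemma alien_deriv_eqI:
  assumes "has_factorial_expansion \<alpha> \<beta> f (fps_nth c)"
  shows "alien_deriv \<alpha> \<beta> f = c"
proof -
  have "(THE c. has_factorial_expansion \<alpha> \<beta> f c) = fps_nth c"
    using assms has_factorial_expansion_unique by blast
  then show ?thesis
    by (simp add: alien_deriv_def fps_nth_inverse)
qed

end

section \<open>Majorants and multivariate composition\<close>

text \<open>The finite geometric sum leaves a remainder divisible by \<open>a ^ Suc n\<close>, which
  cannot reach degree \<open>n\<close>.\<close>

lemma fps_geometric_mult_nth:
  fixes a v :: "real fps"
  assumes "fps_nth a 0 = 0"
  shows "fps_nth (v * inverse (1 - a)) n = (\<Sum>k\<le>n. fps_nth (v * a ^ k) n)"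
proof -
  define u where "u = inverse (1 - a)"
  have u: "(1 - a) * u = 1"
    unfolding u_def using assms by (intro inverse_mult_eq_1') simp
  have "(\<Sum>k\<le>n. a ^ k) = ((1 - a) * u) * (\<Sum>k\<le>n. a ^ k)"
    by (simp add: u)
  also have "\<dots> = ((1 - a) * (\<Sum>k\<le>n. a ^ k)) * u"
    by (simp only: mult_ac)
  also have "\<dots> = u - a ^ Suc n * u"
    unfolding sum_gp_basic by (simp add: left_diff_distrib del: power_Suc)
  finally have "u = (\<Sum>k\<le>n. a ^ k) + a ^ Suc n * u"
    by (simp add: algebra_simps)
  then have "v * u = v * ((\<Sum>k\<le>n. a ^ k) + a ^ Suc n * u)"
    by (rule arg_cong)
  also have "\<dots> = (\<Sum>k\<le>n. v * a ^ k) + a ^ Suc n * (v * u)"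
    by (simp only: distrib_left sum_distrib_left mult_ac)
  finally have "v * u = (\<Sum>k\<le>n. v * a ^ k) + a ^ Suc n * (v * u)" .
  then have "fps_nth (v * u) n =
      (\<Sum>k\<le>n. fps_nth (v * a ^ k) n) + fps_nth (a ^ Suc n * (v * u)) n"
    by (metis fps_add_nth fps_sum_nth)
  also have "fps_nth (a ^ Suc n * (v * u)) n = 0"
    unfolding fps_mult_nth using assms
    by (intro sum.neutral ballI) (simp add: startsby_zero_power_prefix del: power_Suc)
  finally show ?thesis
    by (simp add: u_def)
qed

section \<open>Coefficientwise majorants\<close>

definition majorized :: "real fps \<Rightarrow> real fps \<Rightarrow> bool" where
  "majorized f g \<longleftrightarrow> (\<forall>n. \<bar>fps_nth f n\<bar> \<le> fps_nth g n)"

lemma majorized_add: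
  "majorized f1 g1 \<Longrightarrow> majorized f2 g2 \<Longrightarrow> majorized (f1 + f2) (g1 + g2)"
  unfolding majorized_def by (auto intro: order_trans[OF abs_triangle_ineq] add_mono)

lemma majorized_mult:
  assumes "majorized f1 g1" "majorized f2 g2"
  shows "majorized (f1 * f2) (g1 * g2)"
  unfolding majorized_def
proof
  fix n
  have *: "0 \<le> fps_nth g1 k" "0 \<le> fps_nth g2 k" for k
    using assms unfolding majorized_def by (meson abs_ge_zero order_trans)+
  have "\<bar>fps_nth (f1 * f2) n\<bar> \<le> (\<Sum>k=0..n. \<bar>fps_nth f1 k\<bar> * \<bar>fps_nth f2 (n - k)\<bar>)"
    by (simp add: fps_mult_nth sum_abs flip: abs_mult)
  also have "\<dots> \<le> fps_nth (g1 * g2) n"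
    unfolding fps_mult_nth using assms *
    by (intro sum_mono mult_mono) (auto simp: majorized_def)
  finally show "\<bar>fps_nth (f1 * f2) n\<bar> \<le> fps_nth (g1 * g2) n" .
qed

lemma majorized_self: "(\<And>n. 0 \<le> fps_nth f n) \<Longrightarrow> majorized f f"
  by (simp add: majorized_def)

lemma majorized_nonneg: "majorized f g \<Longrightarrow> 0 \<le> fps_nth g n"
  unfolding majorized_def by (meson abs_ge_zero order_trans)

lemma majorized_power: "majorized f g \<Longrightarrow> majorized (f ^ k) (g ^ k)"
proof (induction k)
  case 0
  then show ?case
    by (simp add: majorized_def)
qed (simp add: majorized_mult)

lemma fps_of_nat_mult_nth: "fps_nth (of_nat k * f) n = real k * fps_nth f n"
  by (simp flip: fps_of_nat)

section \<open>Monomials in several series and their expansion to first order\<close>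

abbreviation mdegree :: "('l::finite \<Rightarrow> nat) \<Rightarrow> nat" where
  "mdegree m \<equiv> \<Sum>i\<in>UNIV. m i"

abbreviation monomial_at :: "('l::finite \<Rightarrow> real fps) \<Rightarrow> ('l \<Rightarrow> nat) \<Rightarrow> real fps" where
  "monomial_at G m \<equiv> \<Prod>i\<in>UNIV. G i ^ m i"

lemma mdegree_Suc: "mdegree (m(l := Suc (m l))) = Suc (mdegree m)"
  by (simp add: sum.remove[of UNIV l])

lemma monomial_at_Suc: "monomial_at G (m(l := Suc (m l))) = G l * monomial_at G m"
  by (simp add: prod.remove[of UNIV l] mult.assoc)

text \<open>Induction on the total degree, lowering a positive exponent. Statements about monomials
  are thereby proved by adding one factor at a time.\<close>

lemma multi_index_induct [case_names zero Suc]: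
  fixes m :: "'l::finite \<Rightarrow> nat"
  assumes zero: "P (\<lambda>_. 0)" and Suc: "\<And>m l. P m \<Longrightarrow> P (m(l := Suc (m l)))"
  shows "P m"
proof (induction "mdegree m" arbitrary: m)
  case 0
  then have "m = (\<lambda>_. 0)"
    by auto
  with zero show ?case
    by simp
next
  case (Suc k)
  then obtain l where l: "m l > 0"
    by (metis gr0I nat.simps(3) sum.neutral)
  define m' where "m' = m(l := m l - 1)"
  have m: "m = m'(l := Suc (m' l))"
    using l by (auto simp: m'_def)
  then have "Suc (mdegree m') = Suc k"
    using Suc.hyps(2) mdegree_Suc[of m' l] by simp
  then have "P m'"
    by (intro Suc.hyps(1)) simp
  then show ?case
    by (subst m) (rule assms(2))
qed

lemma majorized_monomial_at:
  assumes "\<And>i. majorized (G i) s"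
  shows "majorized (monomial_at G m) (s ^ mdegree m)"
proof (induction m rule: multi_index_induct)
  case zero
  then show ?case
    by (simp add: majorized_def)
next
  case (Suc m l)
  show ?case
    unfolding monomial_at_Suc mdegree_Suc power_Suc by (rule majorized_mult[OF assms Suc])
qed

text \<open>The part of the monomial at \<open>P + T\<close> that is linear in \<open>T\<close>.
  Where \<open>m l - 1\<close> truncates, the factor \<open>m l\<close> is zero.\<close>

definition monomial_linear_part ::
    "('l::finite \<Rightarrow> real fps) \<Rightarrow> ('l \<Rightarrow> real fps) \<Rightarrow> ('l \<Rightarrow> nat) \<Rightarrow> real fps" where
  "monomial_linear_part P T m =
     (\<Sum>l\<in>UNIV. of_nat (m l) * (monomial_at P (m(l := m l - 1)) * T l))"

text \<open>The Leibniz rule for an additional factor in the variable \<open>j\<close>: only the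
  summand \<open>l = j\<close> receives an extra term.\<close>

lemma monomial_linear_part_Suc:
  "monomial_linear_part P T (m(j := Suc (m j))) =
     P j * monomial_linear_part P T m + T j * monomial_at P m"
proof -
  have "of_nat ((m(j := Suc (m j))) l) *
      (monomial_at P ((m(j := Suc (m j)))(l := (m(j := Suc (m j))) l - 1)) * T l) =
      P j * (of_nat (m l) * (monomial_at P (m(l := m l - 1)) * T l)) +
      (if l = j then T j * monomial_at P m else 0)" for l
  proof (cases "l = j")
    case True
    show ?thesis
    proof (cases "m j")
      case 0
      then have "m(j := 0) = m"
        by auto
      with True 0 show ?thesis
        by simp
    next
      case (Suc k)
      have "monomial_at P m = P j * monomial_at P (m(j := k))"
        using monomial_at_Suc[of P "m(j := k)" j] Suc by (simp add: fun_upd_idem)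
      moreover have "(m(j := Suc (m j)))(l := (m(j := Suc (m j))) l - 1) = m"
        using True by auto
      ultimately show ?thesis
        using True Suc by (simp add: algebra_simps del: fun_upd_apply) (simp add: algebra_simps)
    qed
  next
    case False
    then have "(m(j := Suc (m j)))(l := m l - 1) =
        (m(l := m l - 1))(j := Suc ((m(l := m l - 1)) j))"
      by auto
    then have "monomial_at P ((m(j := Suc (m j)))(l := m l - 1)) =
        P j * monomial_at P (m(l := m l - 1))"
      by (simp only: monomial_at_Suc)
    with False show ?thesis
      by (simp add: mult_ac del: fun_upd_apply) (simp add: mult_ac)
  qed
  then show ?thesis
    unfolding monomial_linear_part_def by (simp add: sum.distrib sum_distrib_left del: fun_upd_apply)
qed

text \<open>A new factor turns the difference into \<open>P l\<close> times the old difference plus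
  \<open>T l\<close> times the full monomial; the majorants obey the same recursion.\<close>

lemma majorized_monomial_difference:
  assumes P: "\<And>i. majorized (P i) s" and T: "\<And>i. majorized (T i) t"
    and PT: "\<And>i. majorized (P i + T i) s"
  shows "majorized (monomial_at (\<lambda>i. P i + T i) m - monomial_at P m)
           (of_nat (mdegree m) * (s ^ (mdegree m - 1) * t))"
proof (induction m rule: multi_index_induct)
  case zero
  then show ?case
    by (simp add: majorized_def)
next
  case (Suc m l)
  define V where "V = monomial_at (\<lambda>i. P i + T i) m"
  define k where "k = mdegree m"
  have "majorized (P l * (V - monomial_at P m) + T l * V)
      (s * (of_nat k * (s ^ (k - 1) * t)) + t * s ^ k)"
    unfolding V_def k_def
    by (intro majorized_add majorized_mult P T Suc majorized_monomial_at PT)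
  also have "s * (of_nat k * (s ^ (k - 1) * t)) + t * s ^ k =
      of_nat (Suc k) * (s ^ (Suc k - 1) * t)"
    by (cases k) (simp_all add: algebra_simps)
  also have "P l * (V - monomial_at P m) + T l * V = (P l + T l) * V - P l * monomial_at P m"
    by (simp add: algebra_simps)
  finally show ?case
    unfolding monomial_at_Suc monomial_at_Suc[of "\<lambda>i. P i + T i"] mdegree_Suc V_def k_def .
qed

text \<open>The new remainder is \<open>P l\<close> times the old remainder plus \<open>T l\<close>
  times the first-order difference. The binomial coefficient arises from Pascal's rule
  \<open>Suc k choose 2 = k + (k choose 2)\<close>; small \<open>k\<close> are separate because of
  the exponent \<open>k - 2\<close>.\<close>

lemma majorized_monomial_remainder:
  assumes P: "\<And>i. majorized (P i) s" and T: "\<And>i. majorized (T i) t"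
    and PT: "\<And>i. majorized (P i + T i) s"
  shows "majorized
      (monomial_at (\<lambda>i. P i + T i) m - monomial_at P m - monomial_linear_part P T m)
      (of_nat (mdegree m choose 2) * (s ^ (mdegree m - 2) * t\<^sup>2))"
proof (induction m rule: multi_index_induct)
  case zero
  then show ?case
    by (simp add: majorized_def monomial_linear_part_def binomial_eq_0)
next
  case (Suc m l)
  define V where "V = monomial_at (\<lambda>i. P i + T i) m"
  define k where "k = mdegree m"
  have "majorized (P l * (V - monomial_at P m - monomial_linear_part P T m) +
        T l * (V - monomial_at P m))
      (s * (of_nat (k choose 2) * (s ^ (k - 2) * t\<^sup>2)) + t * (of_nat k * (s ^ (k - 1) * t)))"
    unfolding V_def k_def
    by (intro majorized_add majorized_mult P T Suc majorized_monomial_difference PT)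
  also have "s * (of_nat (k choose 2) * (s ^ (k - 2) * t\<^sup>2)) + t * (of_nat k * (s ^ (k - 1) * t)) =
      of_nat (Suc k choose 2) * (s ^ (Suc k - 2) * t\<^sup>2)"
  proof -
    consider "k = 0" | "k = 1" | j where "k = Suc (Suc j)"
      by (metis One_nat_def old.nat.exhaust)
    then show ?thesis
    proof cases
      case 3
      have "Suc k choose 2 = k + (k choose 2)"
        by (simp add: numeral_2_eq_2)
      then show ?thesis
        by (simp add: 3 algebra_simps power2_eq_square)
    qed (simp_all add: power2_eq_square numeral_2_eq_2)
  qed
  also have "P l * (V - monomial_at P m - monomial_linear_part P T m) + T l * (V - monomial_at P m)
      = (P l + T l) * V - P l * monomial_at P m
        - (P l * monomial_linear_part P T m + T l * monomial_at P m)"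
    by (simp add: algebra_simps)
  finally show ?case
    unfolding monomial_at_Suc monomial_at_Suc[of "\<lambda>i. P i + T i"] mdegree_Suc
      monomial_linear_part_Suc V_def k_def .
qed

section \<open>Geometric growth of multivariate coefficients\<close>

definition mfps_geometric :: "real \<Rightarrow> real \<Rightarrow> 'l::finite mfps \<Rightarrow> bool" where
  "mfps_geometric K D F \<longleftrightarrow>
     K \<ge> 0 \<and> D > 0 \<and> (\<forall>k. (\<Sum>m | mdegree m = k. \<bar>F m\<bar>) \<le> K * D ^ k)"

lemma finite_mdegree_eq: "finite {m :: 'l::finite \<Rightarrow> nat. mdegree m = k}"
  by (rule finite_subset[OF _ finite_multi_indices[of k]]) auto

text \<open>Evaluate at the point with all coordinates \<open>r / 2\<close>. Unordered summability
  over the reals is absolute, so each homogeneous slice is at most the total sum; this gives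
  \<open>K\<close>, and \<open>D = 2 / r\<close>.\<close>

lemma mfps_convergent_imp_geometric:
  assumes "mfps_convergent F"
  obtains K D where "mfps_geometric K D F"
proof -
  obtain r where r: "r > 0"
      "\<And>y. (\<forall>i. \<bar>y i\<bar> < r) \<Longrightarrow> (\<lambda>m. F m * (\<Prod>i\<in>UNIV. y i ^ m i)) summable_on UNIV"
    using assms unfolding mfps_convergent_def by blast
  define S where "S = (\<lambda>m. \<bar>F m * (r / 2) ^ mdegree m\<bar>)"
  have "(\<lambda>m. F m * (\<Prod>i\<in>UNIV. (r / 2) ^ m i)) summable_on UNIV"
    using r by (intro r(2)) auto
  then have "S summable_on UNIV"
    by (subst (asm) summable_on_iff_abs_summable_on_real) (simp add: S_def power_sum)
  then have le: "(\<Sum>m | mdegree m = k. S m) \<le> infsum S UNIV" for k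
    by (intro finite_sum_le_infsum finite_mdegree_eq) (auto simp: S_def)
  have "(\<Sum>m | mdegree m = k. \<bar>F m\<bar>) \<le> infsum S UNIV * (2 / r) ^ k" for k
  proof -
    have "(\<Sum>m | mdegree m = k. S m) = (\<Sum>m | mdegree m = k. \<bar>F m\<bar>) * (r / 2) ^ k"
      using r(1) by (simp add: S_def abs_mult sum_distrib_right)
    then have "(\<Sum>m | mdegree m = k. \<bar>F m\<bar>) * (r / 2) ^ k * (2 / r) ^ k \<le>
        infsum S UNIV * (2 / r) ^ k"
      using le[of k] r(1) by (intro mult_right_mono) auto
    moreover have "(r / 2) ^ k * (2 / r) ^ k = 1"
      using r(1) by (simp flip: power_mult_distrib)
    ultimately show ?thesis
      by (simp add: mult.assoc)
  qed
  moreover have "infsum S UNIV \<ge> 0"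
    by (intro infsum_nonneg) (simp add: S_def)
  ultimately show ?thesis
    using that[of "infsum S UNIV" "2 / r"] r(1) by (simp add: mfps_geometric_def)
qed

text \<open>Raising the exponent at \<open>l\<close> is injective from degree \<open>k\<close> into
  degree \<open>Suc k\<close>. The derivative factor is at most \<open>Suc k \<le> 2 ^ k\<close>,
  which doubles \<open>D\<close>.\<close>

lemma mfps_geometric_pderiv:
  assumes "mfps_geometric K D F"
  shows "mfps_geometric (K * D) (2 * D) (mfps_pderiv l F)"
proof -
  have K: "K \<ge> 0" "D > 0" "\<And>k. (\<Sum>m | mdegree m = k. \<bar>F m\<bar>) \<le> K * D ^ k"
    using assms by (auto simp: mfps_geometric_def)
  have "(\<Sum>m | mdegree m = k. \<bar>mfps_pderiv l F m\<bar>) \<le> K * D * (2 * D) ^ k" for k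
  proof -
    have "(\<Sum>m | mdegree m = k. \<bar>mfps_pderiv l F m\<bar>) \<le>
        (\<Sum>m | mdegree m = k. real (Suc k) * \<bar>F (m(l := Suc (m l)))\<bar>)"
    proof (rule sum_mono)
      fix m :: "'a \<Rightarrow> nat"
      assume "m \<in> {m. mdegree m = k}"
      moreover have "m l \<le> mdegree m"
        by (rule member_le_sum) auto
      ultimately show "\<bar>mfps_pderiv l F m\<bar> \<le> real (Suc k) * \<bar>F (m(l := Suc (m l)))\<bar>"
        unfolding mfps_pderiv_def abs_mult by (intro mult_right_mono) auto
    qed
    also have "\<dots> = real (Suc k) * (\<Sum>m\<in>(\<lambda>m. m(l := Suc (m l))) ` {m. mdegree m = k}. \<bar>F m\<bar>)"
    proof -
      have "inj_on (\<lambda>m. m(l := Suc (m l))) {m. mdegree m = k}"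
        by (rule inj_on_inverseI[of _ "\<lambda>m. m(l := m l - 1)"]) simp
      then show ?thesis
        by (simp add: sum.reindex sum_distrib_left)
    qed
    also have "\<dots> \<le> real (Suc k) * (\<Sum>m | mdegree m = Suc k. \<bar>F m\<bar>)"
      by (intro mult_left_mono sum_mono2 finite_mdegree_eq) (auto simp: mdegree_Suc simp del: fun_upd_apply)
    also have "\<dots> \<le> 2 ^ k * (K * D ^ Suc k)"
    proof (intro mult_mono K(3))
      have "Suc k \<le> 2 ^ k"
        by (induction k) auto
      then show "real (Suc k) \<le> 2 ^ k"
        by (metis of_nat_le_iff of_nat_numeral of_nat_power)
    qed (auto intro: sum_nonneg)
    finally show ?thesis
      by (simp add: power_mult_distrib mult_ac)
  qed
  with K show ?thesis
    by (simp add: mfps_geometric_def)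
qed

text \<open>The majorant depends only on the total degree, so grouping by degree reduces the
  multivariate sum to one in a single index.\<close>

lemma geometric_family_bound:
  assumes F: "mfps_geometric K D F" and T: "\<And>m. majorized (T m) (c (mdegree m))"
  shows "\<bar>\<Sum>m | mdegree m \<le> n. F m * fps_nth (T m) n\<bar> \<le> (\<Sum>k\<le>n. K * D ^ k * fps_nth (c k) n)"
proof -
  have c: "fps_nth (c (mdegree m)) n \<ge> 0" for m :: "'a \<Rightarrow> nat"
    using majorized_nonneg[OF T] .
  have "\<bar>\<Sum>m | mdegree m \<le> n. F m * fps_nth (T m) n\<bar> \<le>
      (\<Sum>m | mdegree m \<le> n. \<bar>F m\<bar> * fps_nth (c (mdegree m)) n)"
    using T unfolding majorized_def
    by (intro order_trans[OF sum_abs] sum_mono) (auto simp: abs_mult intro!: mult_left_mono)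
  also have "\<dots> = (\<Sum>k\<le>n. \<Sum>m\<in>{m\<in>{m. mdegree m \<le> n}. mdegree m = k}.
      \<bar>F m\<bar> * fps_nth (c (mdegree m)) n)"
    by (rule sum.group[symmetric]) (auto simp: finite_multi_indices)
  also have "\<dots> \<le> (\<Sum>k\<le>n. K * D ^ k * fps_nth (c k) n)"
  proof (rule sum_mono)
    fix k
    assume "k \<in> {..n}"
    then have "(\<Sum>m\<in>{m\<in>{m. mdegree m \<le> n}. mdegree m = k}. \<bar>F m\<bar> * fps_nth (c (mdegree m)) n)
        = (\<Sum>m | mdegree m = k. \<bar>F m\<bar>) * fps_nth (c k) n"
      unfolding sum_distrib_right by (intro sum.cong) auto
    also have "\<dots> \<le> K * D ^ k * fps_nth (c k) n"
    proof (rule mult_right_mono)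
      show "0 \<le> fps_nth (c k) n"
        \<comment> \<open>Nonnegativity of \<open>c k\<close> is only known through a multi-index of
          total degree \<open>k\<close>; the whole degree is placed on one arbitrary
          variable.\<close>
        using c[of "(\<lambda>_. 0)(undefined := k)"] by (simp add: sum.remove[of UNIV undefined])
    qed (use F in \<open>simp add: mfps_geometric_def\<close>)
    finally show "(\<Sum>m\<in>{m\<in>{m. mdegree m \<le> n}. mdegree m = k}. \<bar>F m\<bar> * fps_nth (c (mdegree m)) n)
        \<le> K * D ^ k * fps_nth (c k) n" .
  qed
  finally show ?thesis .
qed

section \<open>Composition: majorants, derivatives and the Taylor remainder\<close>

lemma mfps_compose_nth:
  "fps_nth (mfps_compose F G) n = (\<Sum>m | mdegree m \<le> n. F m * fps_nth (monomial_at G m) n)"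
  by (simp add: mfps_compose_def)

lemma mfps_compose_majorized:
  assumes F: "mfps_geometric K D F" and G: "\<And>i. majorized (G i) q" and q: "fps_nth q 0 = 0"
  shows "\<bar>fps_nth (mfps_compose F G) n\<bar> \<le> K * fps_nth (inverse (1 - fps_const D * q)) n"
proof -
  have "\<bar>fps_nth (mfps_compose F G) n\<bar> \<le> (\<Sum>k\<le>n. K * D ^ k * fps_nth (q ^ k) n)"
    unfolding mfps_compose_nth
    by (intro geometric_family_bound[where c = "\<lambda>k. q ^ k"] F majorized_monomial_at G)
  also have "\<dots> = K * fps_nth (1 * inverse (1 - fps_const D * q)) n"
    using q by (subst fps_geometric_mult_nth)
      (simp_all add: sum_distrib_left power_mult_distrib mult_ac fps_const_power)
  finally show ?thesis
    by simp
qed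

text \<open>Differentiation shifts the multi-index by one, whereas both sides cut at total degree
  \<open>n\<close>. The cuts match because \<open>t\<close> has no constant term: a multi-index of
  degree \<open>n\<close> on the left contributes only above degree \<open>n\<close>.\<close>

lemma mfps_compose_pderiv_mult_nth:
  assumes P: "\<And>i. fps_nth (P i) 0 = 0" and t: "fps_nth t 0 = 0"
  shows "fps_nth (mfps_compose (mfps_pderiv l F) P * t) n =
    (\<Sum>m | mdegree m \<le> n. F m * fps_nth (of_nat (m l) * (monomial_at P (m(l := m l - 1)) * t)) n)"
proof -
  have vanish: "fps_nth (monomial_at P m * t) n = 0" if "n \<le> mdegree m" for m
  proof -
    have "fps_nth (monomial_at P m) j * fps_nth t (n - j) = 0" if "j \<in> {0..n}" for j
      using mfps_monomial_nth_eq_0[of P j m] P t that \<open>n \<le> mdegree m\<close> by (cases "j = n") auto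
    then show ?thesis
      unfolding fps_mult_nth by (intro sum.neutral) auto
  qed
  have "fps_nth (mfps_compose (mfps_pderiv l F) P * t) n =
      (\<Sum>j=0..n. (\<Sum>m | mdegree m \<le> n. mfps_pderiv l F m * fps_nth (monomial_at P m) j) * fps_nth t (n - j))"
    unfolding fps_mult_nth mfps_compose_nth
  proof (intro sum.cong refl, goal_cases)
    \<comment> \<open>The cut at degree \<open>j\<close> is raised to \<open>n\<close>, independent
      of \<open>j\<close>, so that the two sums can be exchanged.\<close>
    case (1 j)
    then have "(\<Sum>m | mdegree m \<le> j. mfps_pderiv l F m * fps_nth (monomial_at P m) j) =
        (\<Sum>m | mdegree m \<le> n. mfps_pderiv l F m * fps_nth (monomial_at P m) j)"
      by (intro sum.mono_neutral_left) (auto simp: finite_multi_indices P mfps_monomial_nth_eq_0)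
    then show ?case
      by simp
  qed
  also have "\<dots> = (\<Sum>m | mdegree m \<le> n. mfps_pderiv l F m * fps_nth (monomial_at P m * t) n)"
    unfolding sum_distrib_right fps_mult_nth sum_distrib_left
    by (subst sum.swap) (simp add: mult.assoc)
  also have "\<dots> = (\<Sum>m | mdegree m < n. mfps_pderiv l F m * fps_nth (monomial_at P m * t) n)"
    by (rule sum.mono_neutral_right) (auto simp: finite_multi_indices vanish)
  also have "\<dots> = (\<Sum>m | mdegree m \<le> n \<and> m l \<noteq> 0.
      F m * fps_nth (of_nat (m l) * (monomial_at P (m(l := m l - 1)) * t)) n)"
  proof (rule sum.reindex_bij_witness[of _ "\<lambda>m. m(l := m l - 1)" "\<lambda>m. m(l := Suc (m l))"], goal_cases)
    case (1 m)
    then show ?case by simp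
  next
    case (2 m)
    then show ?case by (simp add: mdegree_Suc Suc_le_eq del: fun_upd_apply) simp
  next
    case (3 m)
    then show ?case by auto
  next
    case (4 m)
    then have "m = (m(l := m l - 1))(l := Suc ((m(l := m l - 1)) l))"
      by auto
    then have "mdegree m = Suc (mdegree (m(l := m l - 1)))"
      by (metis mdegree_Suc)
    then show ?case
      using 4 by (simp del: fun_upd_apply)
  next
    case (5 m)
    have "(m(l := Suc (m l)))(l := (m(l := Suc (m l))) l - 1) = m"
      by auto
    then show ?case
      by (simp add: mfps_pderiv_def fps_of_nat_mult_nth del: fun_upd_apply of_nat_Suc)
        (simp add: fun_upd_same)
  qed
  also have "\<dots> = (\<Sum>m | mdegree m \<le> n.
      F m * fps_nth (of_nat (m l) * (monomial_at P (m(l := m l - 1)) * t)) n)"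
    by (rule sum.mono_neutral_left) (auto simp: finite_multi_indices)
  finally show ?thesis .
qed

text \<open>Summing the monomial remainders gives a series in
  \<open>(k choose 2) * D ^ k * s ^ (k - 2)\<close> times the square of \<open>t\<close>. After a
  shift by two, \<open>(k + 2) choose 2 \<le> 2 ^ (k + 2)\<close> turns it into a geometric series
  with ratio \<open>2 * D * s\<close>.\<close>

lemma mfps_compose_taylor_remainder:
  assumes F: "mfps_geometric K D F"
    and P: "\<And>i. majorized (P i) s" and T: "\<And>i. majorized (T i) t"
    and PT: "\<And>i. majorized (P i + T i) s"
    and s: "fps_nth s 0 = 0" and t: "fps_nth t 0 = 0"
  shows "\<bar>fps_nth (mfps_compose F (\<lambda>i. P i + T i) - mfps_compose F P
            - (\<Sum>l\<in>UNIV. mfps_compose (mfps_pderiv l F) P * T l)) n\<bar>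
    \<le> K * (2 * D)\<^sup>2 * fps_nth (t\<^sup>2 * inverse (1 - fps_const (2 * D) * s)) n"
proof -
  have KD: "K \<ge> 0" "D > 0"
    using F by (auto simp: mfps_geometric_def)
  have zero: "fps_nth f 0 = 0" if "majorized f g" "fps_nth g 0 = 0" for f g
    using that unfolding majorized_def by (metis abs_le_zero_iff)
  have P0: "fps_nth (P i) 0 = 0" and T0: "fps_nth (T i) 0 = 0" for i
    using zero P T s t by blast+
  have nonneg: "0 \<le> fps_nth (s ^ k * t\<^sup>2) n" for k
    using majorized_nonneg[OF P] majorized_nonneg[OF T]
    by (blast intro: majorized_nonneg majorized_mult majorized_power majorized_self)
  define r where "r = (\<lambda>m. monomial_at (\<lambda>i. P i + T i) m - monomial_at P m - monomial_linear_part P T m)"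
  have "fps_nth (\<Sum>l\<in>UNIV. mfps_compose (mfps_pderiv l F) P * T l) n =
      (\<Sum>m | mdegree m \<le> n. F m * fps_nth (monomial_linear_part P T m) n)"
    unfolding fps_sum_nth mfps_compose_pderiv_mult_nth[OF P0 T0] monomial_linear_part_def
      sum_distrib_left by (rule sum.swap)
  then have "fps_nth (mfps_compose F (\<lambda>i. P i + T i) - mfps_compose F P
            - (\<Sum>l\<in>UNIV. mfps_compose (mfps_pderiv l F) P * T l)) n =
      (\<Sum>m | mdegree m \<le> n. F m * fps_nth (r m) n)"
    by (simp add: mfps_compose_nth r_def right_diff_distrib sum_subtractf)
  also have "\<bar>\<dots>\<bar> \<le> (\<Sum>k\<le>n. K * D ^ k * fps_nth (of_nat (k choose 2) * (s ^ (k - 2) * t\<^sup>2)) n)"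
    unfolding r_def
    by (rule geometric_family_bound[where c = "\<lambda>k. of_nat (k choose 2) * (s ^ (k - 2) * t\<^sup>2)", OF F])
      (rule majorized_monomial_remainder[OF P T PT])
  \<comment> \<open>The range is enlarged to \<open>k \<le> n + 2\<close> so that dropping the zero
    terms at 0 and 1 leaves \<open>k \<le> n\<close> after the shift.\<close>
  also have "\<dots> \<le> (\<Sum>k<Suc (Suc (Suc n)). K * D ^ k * fps_nth (of_nat (k choose 2) * (s ^ (k - 2) * t\<^sup>2)) n)"
  proof (intro sum_mono2 mult_nonneg_nonneg)
    show "0 \<le> fps_nth (of_nat (k choose 2) * (s ^ (k - 2) * t\<^sup>2)) n" for k
      by (simp add: fps_of_nat_mult_nth nonneg)
  qed (use KD in auto)
  also have "\<dots> = (\<Sum>k\<le>n. K * D ^ (k + 2) * fps_nth (of_nat ((k + 2) choose 2) * (s ^ k * t\<^sup>2)) n)"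
    unfolding sum.lessThan_Suc_shift[of _ "Suc (Suc n)"] sum.lessThan_Suc_shift[of _ "Suc n"]
    by (simp add: lessThan_Suc_atMost binomial_eq_0 del: binomial_Suc_Suc)
  also have "\<dots> \<le> (\<Sum>k\<le>n. K * (2 * D)\<^sup>2 * ((2 * D) ^ k * fps_nth (s ^ k * t\<^sup>2) n))"
  proof (rule sum_mono)
    fix k
    have "real ((k + 2) choose 2) \<le> 2 ^ (k + 2)"
      using binomial_le_pow2[of "k + 2" 2] by (metis of_nat_le_iff of_nat_numeral of_nat_power)
    then have "K * D ^ (k + 2) * (real ((k + 2) choose 2) * fps_nth (s ^ k * t\<^sup>2) n) \<le>
        K * D ^ (k + 2) * (2 ^ (k + 2) * fps_nth (s ^ k * t\<^sup>2) n)"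
      using KD by (intro mult_left_mono mult_right_mono nonneg) auto
    also have "\<dots> = K * (2 * D)\<^sup>2 * ((2 * D) ^ k * fps_nth (s ^ k * t\<^sup>2) n)"
      by (simp add: power_mult_distrib power_add power2_eq_square mult_ac)
    finally show "K * D ^ (k + 2) * fps_nth (of_nat ((k + 2) choose 2) * (s ^ k * t\<^sup>2)) n \<le>
        K * (2 * D)\<^sup>2 * ((2 * D) ^ k * fps_nth (s ^ k * t\<^sup>2) n)"
      by (simp only: fps_of_nat_mult_nth)
  qed
  also have "\<dots> = K * (2 * D)\<^sup>2 * fps_nth (t\<^sup>2 * inverse (1 - fps_const (2 * D) * s)) n"
  proof -
    have "t\<^sup>2 * (fps_const (2 * D) * s) ^ k = fps_const ((2 * D) ^ k) * (s ^ k * t\<^sup>2)" for k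
      unfolding power_mult_distrib[of "fps_const (2 * D)" s] fps_const_power by (simp only: mult_ac)
    then have "fps_nth (t\<^sup>2 * (fps_const (2 * D) * s) ^ k) n =
        (2 * D) ^ k * fps_nth (s ^ k * t\<^sup>2) n" for k
      by (simp only: fps_mult_left_const_nth)
    moreover have "fps_nth (fps_const (2 * D) * s) 0 = 0"
      using s by simp
    ultimately show ?thesis
      by (simp only: fps_geometric_mult_nth sum_distrib_left)
  qed
  finally show ?thesis .
qed

section \<open>The chain rule\<close>

lemma monomial_at_nth_cong:
  assumes "\<And>i k. k < N \<Longrightarrow> fps_nth (G i) k = fps_nth (H i) k" and "n < N"
  shows "fps_nth (monomial_at G m) n = fps_nth (monomial_at H m) n"
  using assms(2)
proof (induction m arbitrary: n rule: multi_index_induct)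
  case (Suc m l)
  then show ?case
    unfolding monomial_at_Suc fps_mult_nth
    by (intro sum.cong refl arg_cong2[where f = "(*)"] assms(1) Suc.IH) auto
qed simp

lemma mfps_compose_nth_cong:
  assumes "\<And>i k. k < N \<Longrightarrow> fps_nth (G i) k = fps_nth (H i) k" and "n < N"
  shows "fps_nth (mfps_compose F G) n = fps_nth (mfps_compose F H) n"
  using monomial_at_nth_cong[of N G H n] assms by (simp add: mfps_compose_nth)

lemma has_factorial_expansion_mfps_compose:
  fixes g c :: "'l::finite \<Rightarrow> real fps"
  assumes \<alpha>: "\<alpha> > 0" and \<beta>: "\<beta> > 0"
    and g: "\<And>l. has_factorial_expansion \<alpha> \<beta> (g l) (fps_nth (c l))"
    and g0: "\<And>l. fps_nth (g l) 0 = 0"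
    and F: "mfps_convergent F"
  shows "has_factorial_expansion \<alpha> \<beta> (mfps_compose F g)
           (fps_nth (\<Sum>l\<in>UNIV. mfps_compose (mfps_pderiv l F) g * c l))"
  unfolding has_factorial_expansion_iff_dominated[OF \<alpha> \<beta>] fps_nth_inverse
proof
  fix R
  define A where "A = gamma_weight \<alpha> \<beta>"
  define O_R where "O_R = dominated (\<lambda>n. A (n - R))"
  define P where "P = (\<lambda>l. fps_cutoff (Suc R) (g l))"
  define T where "T = (\<lambda>l. g l - P l)"
  \<comment> \<open>A single majorant for all \<open>g l\<close>; its truncation \<open>q\<close>
    and tail \<open>t\<close> majorize all \<open>P l\<close> and \<open>T l\<close>.\<close>
  define s where "s = Abs_fps (\<lambda>n. \<Sum>l\<in>UNIV. \<bar>fps_nth (g l) n\<bar>)"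
  define q where "q = fps_cutoff (Suc R) s"
  define t where "t = s - q"
  define B where "B = (\<lambda>l. mfps_compose (mfps_pderiv l F) P)"
  define e where "e = (\<Sum>l\<in>UNIV. B l * fps_cutoff R (c l))"
  define d where "d = (\<Sum>l\<in>UNIV. mfps_compose (mfps_pderiv l F) g * c l)"

  have A: "convolution_weight A"
    unfolding A_def by (rule convolution_weight_gamma_weight[OF \<alpha> \<beta>])
  have A_R: "convolution_weight (\<lambda>n. A (n - R))"
    by (rule convolution_weight_shift[OF A])
  have gR: "dominated (\<lambda>n. A (n - R)) (g l - fps_cutoff R (c l) * Abs_fps A)" for l R
    using g[of l] by (simp add: has_factorial_expansion_iff_dominated[OF \<alpha> \<beta>] A_def fps_nth_inverse)
  have gA: "dominated A (g l)" for l
    using gR[of 0 l] by simp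
  have A_dom: "dominated A (Abs_fps A)"
    by (rule dominatedI[where C = 1]) (auto simp: weight_pos[OF A] less_imp_le)
  have sA: "dominated A s"
  proof -
    have "(\<lambda>n. \<Sum>l\<in>UNIV. \<bar>fps_nth (g l) n\<bar>) \<in> O(A)"
      using gA by (intro big_sum_in_bigo) (simp add: dominated_def)
    then show ?thesis
      by (simp add: dominated_def s_def fps_nth_Abs_fps[abs_def])
  qed
  have tA: "dominated A t"
    unfolding t_def q_def by (intro dominated_diff sA dominated_cutoff)
  have s0: "fps_nth s 0 = 0" and q0: "fps_nth q 0 = 0" and t0: "fps_nth t 0 = 0"
    by (simp_all add: s_def q_def t_def g0)
  have le_s: "\<bar>fps_nth (g l) n\<bar> \<le> fps_nth s n" for l n
    unfolding s_def fps_nth_Abs_fps by (rule member_le_sum) auto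
  have s_nonneg: "fps_nth s n \<ge> 0" for n
    using le_s[of undefined n] by linarith
  have Pq: "majorized (P l) q" and Ps: "majorized (P l) s" and Tt: "majorized (T l) t"
    and gs: "majorized (P l + T l) s" for l
    unfolding majorized_def P_def q_def T_def t_def using le_s s_nonneg by auto
  obtain K D where KD: "mfps_geometric K D F"
    using mfps_convergent_imp_geometric[OF F] by blast

  \<comment> \<open>The majorant \<open>q\<close> is a polynomial, hence dominated even by the
    shifted weight, and so is the geometric series built from it.\<close>
  have composite: "O_R (mfps_compose F' P)" if "mfps_geometric K' D' F'" for K' D' F'
  proof -
    have "O_R (inverse (1 - fps_const D' * q))"
    proof -
      have "fps_const D' * q = fps_cutoff (Suc R) (fps_const D' * s)"
        by (simp add: q_def fps_eq_iff)
      then have "O_R (fps_const D' * q)"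
        unfolding O_R_def by (metis dominated_cutoff)
      then show ?thesis
        unfolding O_R_def by (rule dominated_geometric[OF A_R]) (simp add: q0)
    qed
    then show ?thesis
      unfolding O_R_def
      by (rule dominated_by_multiple) (rule mfps_compose_majorized[OF that Pq q0])
  qed
  have FP: "O_R (mfps_compose F P)"
    by (rule composite[OF KD])
  have B: "O_R (B l)" for l
    unfolding B_def by (rule composite[OF mfps_geometric_pderiv[OF KD]])
  have cut: "O_R (fps_cutoff N f)" for N f
    unfolding O_R_def by (rule dominated_cutoff)

  have remainder: "O_R (mfps_compose F g - mfps_compose F P - (\<Sum>l\<in>UNIV. B l * T l))"
  proof -
    have "dominated A (fps_const (2 * D) * s)"
      using sA by (rule dominated_by_multiple[of _ _ _ "\<bar>2 * D\<bar>"]) (simp add: abs_mult s_nonneg)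
    then have u: "dominated A (inverse (1 - fps_const (2 * D) * s))"
      by (rule dominated_geometric[OF A]) (simp add: s0)
    \<comment> \<open>Both copies of \<open>t\<close> vanish below degree \<open>R\<close>, so the
      product gains \<open>R\<close> indices.\<close>
    have "dominated (\<lambda>n. A (n - R)) (t * t * inverse (1 - fps_const (2 * D) * s))"
      using tA u unfolding A_def
      by (intro dominated_tail_product[OF \<alpha> \<beta>]) (simp_all add: t_def q_def)
    moreover have "\<bar>fps_nth (mfps_compose F (\<lambda>i. P i + T i) - mfps_compose F P
            - (\<Sum>l\<in>UNIV. B l * T l)) n\<bar>
        \<le> K * (2 * D)\<^sup>2 * fps_nth (t * t * inverse (1 - fps_const (2 * D) * s)) n" for n
      using mfps_compose_taylor_remainder[of K D F P s T t n] KD Ps Tt gs s0 t0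
      by (simp add: B_def power2_eq_square)
    ultimately have "O_R (mfps_compose F (\<lambda>i. P i + T i) - mfps_compose F P
            - (\<Sum>l\<in>UNIV. B l * T l))"
      unfolding O_R_def by (rule dominated_by_multiple)
    then show ?thesis
      by (simp add: T_def)
  qed

  have linear: "O_R ((\<Sum>l\<in>UNIV. B l * T l) - e * Abs_fps A)"
  proof -
    \<comment> \<open>Write \<open>T l\<close> as \<open>g l - P l\<close> and subtract the
      expansion of \<open>g l\<close> to order \<open>R\<close>; what remains besides
      \<open>e * Abs_fps A\<close> is an expansion error and a polynomial, each multiplied by
      \<open>B l\<close>.\<close>
    have "O_R (\<Sum>l\<in>UNIV. B l * (g l - fps_cutoff R (c l) * Abs_fps A) - B l * P l)"
      using B cut gR unfolding O_R_def P_def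
      by (intro dominated_sum dominated_diff[where f = "_ * _"] dominated_mult[OF A_R]) auto
    also have "(\<Sum>l\<in>UNIV. B l * (g l - fps_cutoff R (c l) * Abs_fps A) - B l * P l) =
        (\<Sum>l\<in>UNIV. B l * T l) - e * Abs_fps A"
      by (simp add: e_def T_def sum_distrib_right right_diff_distrib mult.assoc
          flip: sum_subtractf) (simp add: algebra_simps)
    finally show ?thesis .
  qed

  have "O_R e"
    using B cut unfolding O_R_def e_def by (intro dominated_sum dominated_mult[OF A_R]) auto
  then have cutoff_e: "O_R (e * Abs_fps A - fps_cutoff R e * Abs_fps A)"
    using A_dom unfolding O_R_def A_def by (intro dominated_mult_sub_cutoff[OF \<alpha> \<beta>])

  \<comment> \<open>Below degree \<open>R\<close>, neither truncating \<open>c l\<close> nor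
    evaluating the derivative at \<open>P\<close> instead of \<open>g\<close> changes a coefficient
    of the product.\<close>
  have "fps_cutoff R e = fps_cutoff R d"
  proof -
    have "fps_nth (B l * fps_cutoff R (c l)) n =
        fps_nth (mfps_compose (mfps_pderiv l F) g * c l) n" if "n < R" for l n
    proof -
      have "fps_nth (B l) k = fps_nth (mfps_compose (mfps_pderiv l F) g) k" if "k \<le> n" for k
        unfolding B_def using that \<open>n < R\<close>
        by (intro mfps_compose_nth_cong[of "Suc R"]) (auto simp: P_def)
      then show ?thesis
        unfolding fps_mult_nth using that by (intro sum.cong) auto
    qed
    then show ?thesis
      by (simp add: fps_cutoff_eq_fps_cutoff_iff e_def d_def fps_sum_nth)
  qed
  moreover have "O_R (mfps_compose F g - fps_cutoff R e * Abs_fps A)"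
  proof -
    \<comment> \<open>The sum telescopes: Taylor remainder, composition with the polynomials, linear
      part, and truncation of its coefficient series.\<close>
    have "O_R ((mfps_compose F g - mfps_compose F P - (\<Sum>l\<in>UNIV. B l * T l)) + mfps_compose F P
        + ((\<Sum>l\<in>UNIV. B l * T l) - e * Abs_fps A) + (e * Abs_fps A - fps_cutoff R e * Abs_fps A))"
      using FP remainder linear cutoff_e unfolding O_R_def by (intro dominated_add)
    then show ?thesis
      by simp
  qed
  ultimately show "dominated (\<lambda>n. gamma_weight \<alpha> \<beta> (n - R))
      (mfps_compose F g - fps_cutoff R (\<Sum>l\<in>UNIV. mfps_compose (mfps_pderiv l F) g * c l) *
        Abs_fps (gamma_weight \<alpha> \<beta>))"
    by (simp add: O_R_def A_def d_def)
qed

theorem mainTheorem2: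
  fixes \<alpha> \<beta> :: real
    and g :: "'l::finite \<Rightarrow> real fps"
    and f :: "'l mfps"
  assumes "\<alpha> > 0" and "\<beta> > 0"
    and "\<And>l. g l \<in> factorial_fps \<alpha> \<beta>"
    and "\<And>l. fps_nth (g l) 0 = 0"
    and "mfps_convergent f"
  shows "mfps_compose f g \<in> factorial_fps \<alpha> \<beta> \<and>
    alien_deriv \<alpha> \<beta> (mfps_compose f g) =
      (\<Sum>l\<in>UNIV. mfps_compose (mfps_pderiv l f) g * alien_deriv \<alpha> \<beta> (g l))"
proof -
  \<comment> \<open>By uniqueness, the definite description in \<open>alien_deriv\<close> picks the
    expansion that membership provides.\<close>
  have "has_factorial_expansion \<alpha> \<beta> (g l) (fps_nth (alien_deriv \<alpha> \<beta> (g l)))" for l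
  proof -
    obtain c where c: "has_factorial_expansion \<alpha> \<beta> (g l) (fps_nth (Abs_fps c))"
      using assms(3)[of l] by (auto simp: factorial_fps_def fps_nth_Abs_fps[abs_def])
    with alien_deriv_eqI[OF assms(1,2) c] show ?thesis
      by simp
  qed
  with assms have "has_factorial_expansion \<alpha> \<beta> (mfps_compose f g)
      (fps_nth (\<Sum>l\<in>UNIV. mfps_compose (mfps_pderiv l f) g * alien_deriv \<alpha> \<beta> (g l)))"
    by (intro has_factorial_expansion_mfps_compose)
  then show ?thesis
    using alien_deriv_eqI[OF assms(1,2)] by (auto simp: factorial_fps_def)
qed

end
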